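(* Let $a\in\mathbb{R}^d$ be strictly, symmetrically decreasing and collision-free in frequency, and let $\phi_1,\dots,\phi_4\in\mathbb{C}^d$ and $x\in\mathbb{C}^d$ satisfy $$\operatorname{Re}\Bigl[(c_{i,k}+c_{i,-k})\,\overline{(c_{i,j}+c_{i,-j})}\Bigr]\neq0\qquad\text{for } k,j=0,\dots,\lfloor d/2\rfloor,\ i=1,\dots,4,$$ where $c_{i,k}:=\overline{\hat x_k}\,\hat\phi_{i,k}$. If the real-valued vectors $$\bigl(\operatorname{Re}[\overline{c_{i,0}}\hat\phi_{i,k}],\ \operatorname{Im}[\overline{c_{i,0}}\hat\phi_{i,k}],\ \operatorname{Re}[\overline{c_{i,0}}\hat\phi_{i,-k}],\ \operatorname{Im}[\overline{c_{i,0}}\hat\phi_{i,-k}]\bigr)^{\mathsf T},\qquad i=1,\dots,4,$$ are linearly independent for each $k=1,\dots,\lfloor (d-1)/2\rfloor$, then $a$ and $x$ can be recovered from the samples $$\bigl\{|\langle x,(\operatorname{circ}a)^\ell\phi_i\rangle|\bigr\}_{\ell=0,\,i=1}^{L-1,\,4}\quad\text{with}\quad L:=\bigl(\lfloor\tfrac d2\rfloor+1\bigr)\bigl(\lfloor\tfrac d2\rfloor+2\bigr)$$ up to global phase.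
   Context: The sampling vectors $\phi_1,\dots,\phi_4$ are known; $a$ and $x$ are unknown. $\hat v=Fv$ denotes the discrete Fourier transform of $v\in\mathbb{C}^d$, $F=(e^{-2\pi i jk/d})_{j,k=0}^{d-1}$; indices of vectors are taken modulo $d$; $\hat\phi_{i,k}$ is the $k$th component of $\hat\phi_i$. $\operatorname{circ}a$ is the circulant matrix with first column $a$ (cyclic convolution with $a$). The kernel $a$ is strictly, symmetrically decreasing if all $\hat a_k$ are real and positive, $\hat a_k=\hat a_{-k}$ for all $k$, and $\hat a_k>\hat a_j$ for all $k,j\in\{0,\dots,\lfloor d/2\rfloor\}$ with $k<j$. It is collision-free in frequency if the products $\hat a_j\hat a_k$ with $j,k\in\{0,\dots,\lfloor d/2\rfloor\}$, $j\ge k$, are pairwise distinct.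
   Formalization: The dimension d = 2 is excluded: there the independence condition is void and the claim fails, e.g. for â = (2,1), all φ̂_i = (1,1), x̂ = (1, e^{iπ/3}), whose samples equal those of (1, e^{-iπ/3}). *)

theory Defs
  imports "HOL-Analysis.Product_Vector" "Jordan_Normal_Form.Matrix"
begin

text \<open>Vector entries with the index read modulo the dimension, so that negative indices make sense.\<close>

definition cyc_index :: "'a vec \<Rightarrow> int \<Rightarrow> 'a" (infixl \<open>$\<^sub>c\<close> 100) where
  "v $\<^sub>c k = v $ nat (k mod int (dim_vec v))"

definition fourier_mat :: "nat \<Rightarrow> complex mat" where
  "fourier_mat d = mat d d (\<lambda>(j, k). exp (- 2 * of_real pi * \<i> * of_nat j * of_nat k / of_nat d))"

definition dft :: "complex vec \<Rightarrow> complex vec" where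
  "dft v = fourier_mat (dim_vec v) *\<^sub>v v"

definition circ :: "'a vec \<Rightarrow> 'a mat" where
  "circ a = mat (dim_vec a) (dim_vec a) (\<lambda>(j, k). a $\<^sub>c (int j - int k))"

abbreviation complexify :: "real vec \<Rightarrow> complex vec" where
  "complexify a \<equiv> map_vec complex_of_real a"

definition strict_sym_decreasing :: "real vec \<Rightarrow> bool" where
  "strict_sym_decreasing a \<longleftrightarrow>
    (let ah = dft (complexify a); d = int (dim_vec a) in
      (\<forall>k. ah $\<^sub>c k \<in> \<real> \<and> Re (ah $\<^sub>c k) > 0) \<and>
      (\<forall>k. ah $\<^sub>c k = ah $\<^sub>c (- k)) \<and>
      (\<forall>k\<in>{0..d div 2}. \<forall>j\<in>{0..d div 2}. k < j \<longrightarrow> Re (ah $\<^sub>c k) > Re (ah $\<^sub>c j)))"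

definition collision_free_in_frequency :: "real vec \<Rightarrow> bool" where
  "collision_free_in_frequency a \<longleftrightarrow>
    (let ah = dft (complexify a); d = int (dim_vec a) in
      inj_on (\<lambda>(j, k). ah $\<^sub>c j * ah $\<^sub>c k)
        {(j, k). j \<in> {0..d div 2} \<and> k \<in> {0..d div 2} \<and> j \<ge> k})"

text \<open>Linear independence of an indexed family: \<^term>\<open>independent\<close> alone speaks about the set of
  values and would not exclude repetitions.\<close>

definition independent_family :: "('i \<Rightarrow> 'v::real_vector) \<Rightarrow> 'i set \<Rightarrow> bool" where
  "independent_family v I \<longleftrightarrow> inj_on v I \<and> independent (v ` I)"

definition sample :: "real vec \<Rightarrow> complex vec \<Rightarrow> complex vec \<Rightarrow> nat \<Rightarrow> real" where
  "sample a x \<phi> l = cmod (x \<bullet>c ((circ (complexify a) ^\<^sub>m l) *\<^sub>v \<phi>))"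

text \<open>Identifiability: among all kernels that are known a priori to be strictly, symmetrically
  decreasing and collision-free in frequency, and among all signals whatsoever, the samples
  taken with \<open>\<phi> 1, \<dots>, \<phi> 4\<close> leave only \<open>a\<close> itself and the unimodular multiples of \<open>x\<close>.\<close>

definition recoverable_up_to_phase ::
    "(nat \<Rightarrow> complex vec) \<Rightarrow> nat \<Rightarrow> real vec \<Rightarrow> complex vec \<Rightarrow> bool" where
  "recoverable_up_to_phase \<phi> L a x \<longleftrightarrow>
    (\<forall>a' \<in> carrier_vec (dim_vec a). \<forall>x' \<in> carrier_vec (dim_vec x).
      strict_sym_decreasing a' \<longrightarrow> collision_free_in_frequency a' \<longrightarrow>
      (\<forall>l<L. \<forall>i\<in>{1..4}. sample a' x' (\<phi> i) l = sample a x (\<phi> i) l) \<longrightarrow>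
      a' = a \<and> (\<exists>\<theta>. cmod \<theta> = 1 \<and> x' = \<theta> \<cdot>\<^sub>v x))"

end

theory Submission
  imports Defs "HOL-Analysis.Linear_Algebra" "HOL-Library.Real_Mod"
    "HOL-Computational_Algebra.Polynomial"
begin

text \<open>
  Diagonalising the circulant matrix by the Fourier transform, the squared sample at time \<open>l\<close> is the
  moment \<open>\<Sum> w\<^sub>j\<^sub>k (b\<^sub>j b\<^sub>k)\<^sup>l\<close> over the pairs \<open>0 \<le> k \<le> j \<le> d div 2\<close>, where \<open>b\<close> is the spectrum of the kernel and
  \<open>w\<^sub>j\<^sub>k\<close> is a positive multiple of \<open>Re (S\<^sub>j cnj S\<^sub>k)\<close> with \<open>S\<^sub>k = c\<^sub>k + c\<^sub>-\<^sub>k\<close>. By collision-freeness the nodes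
  \<open>b\<^sub>j b\<^sub>k\<close> are distinct, so \<open>L\<close> moments (twice the number of pairs) determine the set of nodes and the
  weights, as in Prony's method. A decreasing sequence is determined by the set of its pairwise
  products: once \<open>b\<^sub>0, \<dots>, b\<^sub>m\<^sub>-\<^sub>1\<close> are known, \<open>b\<^sub>0 b\<^sub>m\<close> is the largest product not formed from them.
  This recovers the kernel. The weights fix \<open>\<bar>x\<^sub>0\<bar>\<close> on the Fourier side and, after normalising the global
  phase, are real-linear in the pair of entries at \<open>k\<close> and \<open>-k\<close>, which four independent functionals determine.
\<close>

section \<open>Sums over residues\<close>

lemma sum_nat_eq_sum_int:
  fixes g :: "int \<Rightarrow> 'a::comm_monoid_add"
  assumes "\<And>i. i < d \<Longrightarrow> f i = g (int i)"
  shows "(\<Sum>i = 0..<d. f i) = (\<Sum>k\<in>{0..<int d}. g k)"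
  by (rule sum.reindex_bij_witness[of _ nat int]) (use assms in auto)

lemma sum_residues_shift:
  fixes f :: "int \<Rightarrow> 'a::comm_monoid_add"
  assumes per: "\<And>k. f (k mod int d) = f k"
  shows "(\<Sum>k\<in>{0..<int d}. f (k + m)) = (\<Sum>k\<in>{0..<int d}. f k)"
proof (cases "d = 0")
  case False
  show ?thesis
  proof (rule sum.reindex_bij_witness[of _ "\<lambda>k. (k - m) mod int d" "\<lambda>k. (k + m) mod int d"])
    show "((k - m) mod int d + m) mod int d = k" if "k \<in> {0..<int d}" for k
      using that by (simp add: mod_add_left_eq)
    show "((k + m) mod int d - m) mod int d = k" if "k \<in> {0..<int d}" for k
      using that by (simp add: mod_diff_left_eq)
  qed (use False per in auto)
qed auto

text \<open>A residue fixed by \<open>k \<mapsto> -k\<close> (\<open>0\<close> and, for even \<open>d\<close>, \<open>d div 2\<close>) is counted twice in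
  \<open>f k + f (- k)\<close>, hence the weight \<open>1/2\<close>.\<close>

definition fold_weight :: "nat \<Rightarrow> int \<Rightarrow> real" where
  "fold_weight d k = (if int d dvd 2 * k then 1 / 2 else 1)"

lemma fold_weight_pos: "fold_weight d k > 0"
  by (simp add: fold_weight_def)

text \<open>The reflection \<open>k \<mapsto> int d - k\<close> carries the residues above
  \<open>int d div 2\<close> onto the lower ones that are not their own negatives, so the terms pair
  up as \<open>f k + f (- k)\<close>.\<close>

lemma sum_residues_fold:
  fixes f :: "int \<Rightarrow> complex"
  assumes d: "d \<ge> 1" and per: "\<And>k. f (k mod int d) = f k"
  shows "(\<Sum>k\<in>{0..<int d}. f k) =
    (\<Sum>k\<in>{0..int d div 2}. of_real (fold_weight d k) * (f k + f (- k)))"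
proof -
  define n where "n = int d div 2"
  let ?T = "{k\<in>{0..n}. \<not> int d dvd 2 * k}"
  have shift: "f (k - int d) = f k" for k
    by (metis per minus_mod_self2)
  \<comment> \<open>For such \<open>k\<close> the number \<open>2 * k\<close> lies between
    \<open>0\<close> and \<open>int d\<close>, so divisibility leaves only the two
    endpoints.\<close>
  have dvd: "int d dvd 2 * k \<longleftrightarrow> k = 0 \<or> 2 * k = int d" if "k \<in> {0..n}" for k
  proof -
    have "0 \<le> 2 * k" "2 * k \<le> int d" using that by (auto simp: n_def)
    then show ?thesis
      using zdvd_imp_le[of "int d" "2 * k"] by (cases "k = 0") auto
  qed
  have split: "{0..<int d} = {0..n} \<union> {n<..<int d}"
    using d by (auto simp: n_def)
  have upper: "(\<Sum>k\<in>{n<..<int d}. f k) = (\<Sum>k\<in>?T. f (- k))"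
  proof (rule sum.reindex_bij_witness[of _ "\<lambda>k. int d - k" "\<lambda>k. int d - k"])
    show "int d - k \<in> ?T" if "k \<in> {n<..<int d}" for k
    proof -
      have "int d - k \<in> {0..n}" using that by (auto simp: n_def)
      moreover have "int d - k \<noteq> 0" "2 * (int d - k) \<noteq> int d"
        using that by (auto simp: n_def)
      ultimately show ?thesis using dvd by blast
    qed
    show "int d - k \<in> {n<..<int d}" if "k \<in> ?T" for k
    proof -
      have "k \<in> {0..n}" "k \<noteq> 0" "2 * k \<noteq> int d" using that dvd[of k] by auto
      then show ?thesis by (auto simp: n_def)
    qed
  qed (auto simp: shift)
  have "(\<Sum>k\<in>{0..<int d}. f k) = (\<Sum>k\<in>{0..n}. f k) + (\<Sum>k\<in>?T. f (- k))"
    unfolding split using upper by (subst sum.union_disjoint) auto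
  also have "(\<Sum>k\<in>?T. f (- k)) = (\<Sum>k\<in>{0..n}. if int d dvd 2 * k then 0 else f (- k))"
    by (rule sum.mono_neutral_cong_left) auto
  also have "(\<Sum>k\<in>{0..n}. f k) + \<dots> =
      (\<Sum>k\<in>{0..n}. of_real (fold_weight d k) * (f k + f (- k)))"
    unfolding sum.distrib[symmetric]
  proof (rule sum.cong)
    fix k assume k: "k \<in> {0..n}"
    have "f (- k) = f k" if "int d dvd 2 * k"
    proof -
      have "(- k) mod int d = k mod int d"
        using that by (simp add: mod_eq_dvd_iff)
      then show ?thesis by (metis per)
    qed
    then show "f k + (if int d dvd 2 * k then 0 else f (- k)) =
        of_real (fold_weight d k) * (f k + f (- k))"
      by (simp add: fold_weight_def)
  qed simp
  finally show ?thesis by (simp add: n_def)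
qed

section \<open>The discrete Fourier transform\<close>

lemma dim_dft [simp]: "dim_vec (dft v) = dim_vec v"
  by (simp add: dft_def fourier_mat_def)

lemma cyc_index_of_nat: "i < dim_vec v \<Longrightarrow> v $\<^sub>c int i = v $ i"
  by (simp add: cyc_index_def)

lemma cyc_index_mod [simp]: "dim_vec v = d \<Longrightarrow> v $\<^sub>c (k mod int d) = v $\<^sub>c k"
  by (simp add: cyc_index_def)

lemma cyc_index_cong:
  "dim_vec v = d \<Longrightarrow> k mod int d = j mod int d \<Longrightarrow> v $\<^sub>c k = v $\<^sub>c j"
  by (simp add: cyc_index_def)

section \<open>Characters modulo \<open>d\<close> and the transform as a sum over them\<close>

definition omega :: "nat \<Rightarrow> int \<Rightarrow> complex" where
  "omega d m = cis (- 2 * pi * of_int m / of_nat d)"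

lemma omega_add: "omega d (m + n) = omega d m * omega d n"
  by (simp add: omega_def cis_mult algebra_simps add_divide_distrib diff_divide_distrib)

lemma cnj_omega: "cnj (omega d m) = omega d (- m)"
  by (simp add: omega_def cis_cnj)

lemma omega_eq_1_iff:
  assumes "d \<ge> 1"
  shows "omega d m = 1 \<longleftrightarrow> int d dvd m"
proof -
  have "- 2 * pi * of_int m / of_nat d = of_int n * (2 * pi) \<longleftrightarrow> m = int d * (- n)" for n
  proof -
    have "- 2 * pi * of_int m / of_nat d = of_int n * (2 * pi) \<longleftrightarrow>
        pi * real_of_int m = pi * real_of_int (int d * (- n))"
      using assms by (auto simp: field_simps)
    then show ?thesis by (simp only: mult_cancel_left pi_neq_zero of_int_eq_iff simp_thms)
  qed
  then have "omega d m = 1 \<longleftrightarrow> (\<exists>n. m = int d * (- n))"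
    unfolding omega_def cis_eq_1_iff by simp
  also have "\<dots> \<longleftrightarrow> int d dvd m"
    by (metis dvd_def minus_minus)
  finally show ?thesis .
qed

lemma omega_mod: "d \<ge> 1 \<Longrightarrow> omega d (m mod int d) = omega d m"
proof -
  assume d: "d \<ge> 1"
  have "omega d m = omega d (int d * (m div int d)) * omega d (m mod int d)"
    by (simp flip: omega_add)
  moreover have "omega d (int d * (m div int d)) = 1"
    using d by (simp add: omega_eq_1_iff)
  ultimately show ?thesis by simp
qed

lemma omega_cong: "d \<ge> 1 \<Longrightarrow> m mod int d = n mod int d \<Longrightarrow> omega d m = omega d n"
  by (metis omega_mod)

text \<open>Replacing \<open>m\<close> by \<open>m + 1\<close> permutes the residues and multiplies
  the sum by \<open>omega d r\<close>; unless that factor is \<open>1\<close>, the sum must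
  vanish.\<close>

lemma sum_omega:
  assumes d: "d \<ge> 1"
  shows "(\<Sum>m\<in>{0..<int d}. omega d (r * m)) = (if int d dvd r then of_nat d else 0)"
proof (cases "int d dvd r")
  case True
  then have "omega d (r * m) = 1" for m using d by (simp add: omega_eq_1_iff)
  then show ?thesis using True by simp
next
  case False
  let ?S = "\<Sum>m\<in>{0..<int d}. omega d (r * m)"
  have "?S = (\<Sum>m\<in>{0..<int d}. omega d (r * (m + 1)))"
    by (rule sum_residues_shift[symmetric]) (rule omega_cong[OF d], simp add: mod_mult_right_eq)
  also have "\<dots> = ?S * omega d r"
    by (simp add: ring_distribs omega_add sum_distrib_right)
  finally have "?S * (1 - omega d r) = 0" by (simp add: algebra_simps)
  then show ?thesis using False omega_eq_1_iff[OF d, of r] by auto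
qed

text \<open>Over integer residues, periodicity allows summation variables to be translated, and
  negative frequencies need no special treatment.\<close>

lemma dft_cyc_index:
  assumes v: "v \<in> carrier_vec d" and d: "d \<ge> 1"
  shows "dft v $\<^sub>c k = (\<Sum>j\<in>{0..<int d}. omega d (k * j) * v $\<^sub>c j)"
proof -
  have dim: "dim_vec v = d" using v by simp
  define m where "m = nat (k mod int d)"
  have m: "m < d" "int m = k mod int d" using d by (auto simp: m_def nat_less_iff)
  have "dft v $\<^sub>c k = (\<Sum>j = 0..<d. exp (- 2 * of_real pi * \<i> * of_nat m * of_nat j / of_nat d) * v $ j)"
    using dim m(1)
    by (simp add: cyc_index_def dft_def fourier_mat_def scalar_prod_def flip: m_def)
  also have "\<dots> = (\<Sum>j\<in>{0..<int d}. omega d (k * j) * v $\<^sub>c j)"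
  proof (rule sum_nat_eq_sum_int)
    fix i assume i: "i < d"
    have "omega d (k * int i) = omega d (int m * int i)"
      using d m by (intro omega_cong) (auto simp: mod_mult_left_eq)
    also have "\<dots> = exp (- 2 * of_real pi * \<i> * of_nat m * of_nat i / of_nat d)"
      by (simp add: omega_def cis_conv_exp mult_ac)
    finally show "exp (- 2 * of_real pi * \<i> * of_nat m * of_nat i / of_nat d) * v $ i =
        omega d (k * int i) * v $\<^sub>c int i"
      using i dim by (simp add: cyc_index_of_nat)
  qed
  finally show ?thesis .
qed

section \<open>Circulant matrices are diagonal on the Fourier side\<close>

lemma circ_carrier: "a \<in> carrier_vec d \<Longrightarrow> circ a \<in> carrier_mat d d"
  by (auto simp: circ_def)

lemma circ_mult_cyc_index:
  assumes a: "a \<in> carrier_vec d" and v: "v \<in> carrier_vec d" and d: "d \<ge> 1"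
  shows "(circ a *\<^sub>v v) $\<^sub>c j = (\<Sum>k\<in>{0..<int d}. a $\<^sub>c (j - k) * v $\<^sub>c k)"
proof -
  have dim: "dim_vec v = d" "dim_vec a = d" using v a by auto
  define m where "m = nat (j mod int d)"
  have m: "m < d" "int m = j mod int d" using d by (auto simp: m_def nat_less_iff)
  have "(circ a *\<^sub>v v) $\<^sub>c j = (\<Sum>k = 0..<d. a $\<^sub>c (int m - int k) * v $ k)"
    using dim m(1) by (simp add: cyc_index_def circ_def scalar_prod_def flip: m_def)
  also have "\<dots> = (\<Sum>k\<in>{0..<int d}. a $\<^sub>c (j - k) * v $\<^sub>c k)"
  proof (rule sum_nat_eq_sum_int)
    fix i assume i: "i < d"
    have "a $\<^sub>c (int m - int i) = a $\<^sub>c (j - int i)"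
      by (rule cyc_index_cong[OF dim(2)]) (simp add: m mod_diff_left_eq)
    then show "a $\<^sub>c (int m - int i) * v $ i = a $\<^sub>c (j - int i) * v $\<^sub>c int i"
      using i dim by (simp add: cyc_index_of_nat)
  qed
  finally show ?thesis .
qed

lemma dft_circ_mult:
  assumes a: "a \<in> carrier_vec d" and v: "v \<in> carrier_vec d" and d: "d \<ge> 1"
  shows "dft (circ a *\<^sub>v v) $\<^sub>c m = dft a $\<^sub>c m * dft v $\<^sub>c m"
proof -
  have dim: "dim_vec a = d" using a by auto
  have av: "circ a *\<^sub>v v \<in> carrier_vec d"
    by (rule mult_mat_vec_carrier[OF circ_carrier[OF a] v])
  \<comment> \<open>Translating the summation variable by \<open>k\<close> splits off the character
    at \<open>k\<close>; this is the core of the convolution theorem.\<close>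
  have inner: "(\<Sum>j\<in>{0..<int d}. omega d (m * j) * a $\<^sub>c (j - k)) =
      omega d (m * k) * dft a $\<^sub>c m" for k
  proof -
    let ?f = "\<lambda>j. omega d (m * (j + k)) * a $\<^sub>c j"
    have "(\<Sum>j\<in>{0..<int d}. omega d (m * j) * a $\<^sub>c (j - k)) =
        (\<Sum>j\<in>{0..<int d}. ?f (j + - k))" by simp
    also have "\<dots> = (\<Sum>j\<in>{0..<int d}. ?f j)"
    proof (rule sum_residues_shift)
      fix j
      have "omega d (m * (j mod int d + k)) = omega d (m * (j + k))"
        by (rule omega_cong[OF d]) (metis mod_mult_right_eq mod_add_left_eq)
      then show "?f (j mod int d) = ?f j" by (simp add: dim)
    qed
    also have "\<dots> = omega d (m * k) * dft a $\<^sub>c m"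
      by (simp add: dft_cyc_index[OF a d] sum_distrib_left ring_distribs omega_add mult_ac)
    finally show ?thesis .
  qed
  have "dft (circ a *\<^sub>v v) $\<^sub>c m =
      (\<Sum>j\<in>{0..<int d}. \<Sum>k\<in>{0..<int d}. omega d (m * j) * a $\<^sub>c (j - k) * v $\<^sub>c k)"
    by (simp add: dft_cyc_index[OF av d] circ_mult_cyc_index[OF a v d] sum_distrib_left mult_ac)
  also have "\<dots> = (\<Sum>k\<in>{0..<int d}. (\<Sum>j\<in>{0..<int d}. omega d (m * j) * a $\<^sub>c (j - k)) * v $\<^sub>c k)"
    by (subst sum.swap) (simp add: sum_distrib_right)
  also have "\<dots> = dft a $\<^sub>c m * dft v $\<^sub>c m"
    unfolding inner dft_cyc_index[OF v d] sum_distrib_left by (simp add: mult_ac)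
  finally show ?thesis .
qed

lemma dft_circ_power_mult:
  assumes a: "a \<in> carrier_vec d" and v: "v \<in> carrier_vec d" and d: "d \<ge> 1"
  shows "dft ((circ a ^\<^sub>m l) *\<^sub>v v) $\<^sub>c m = (dft a $\<^sub>c m) ^ l * dft v $\<^sub>c m"
  using v
proof (induction l arbitrary: v)
  case 0
  then show ?case using circ_carrier[OF a] by simp
next
  case (Suc l)
  have "(circ a ^\<^sub>m Suc l) *\<^sub>v v = (circ a ^\<^sub>m l) *\<^sub>v (circ a *\<^sub>v v)"
    using circ_carrier[OF a] Suc.prems by (simp add: assoc_mult_mat_vec[of _ d d _ d])
  then show ?case
    using Suc.IH[OF mult_mat_vec_carrier[OF circ_carrier[OF a] Suc.prems]]
    by (simp add: dft_circ_mult[OF a Suc.prems d])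
qed

section \<open>Parseval identity and injectivity of the transform\<close>

lemma scalar_prod_dft:
  assumes x: "x \<in> carrier_vec d" and y: "y \<in> carrier_vec d" and d: "d \<ge> 1"
  shows "(\<Sum>m\<in>{0..<int d}. dft x $\<^sub>c m * cnj (dft y $\<^sub>c m)) = of_nat d * (x \<bullet>c y)"
proof -
  let ?D = "{0..<int d}"
  have omega: "omega d (m * (j - k)) = omega d (m * j) * cnj (omega d (m * k))" for m j k
    by (simp add: cnj_omega algebra_simps flip: omega_add)
  have "(\<Sum>m\<in>?D. dft x $\<^sub>c m * cnj (dft y $\<^sub>c m)) =
      (\<Sum>m\<in>?D. \<Sum>j\<in>?D. \<Sum>k\<in>?D. x $\<^sub>c j * cnj (y $\<^sub>c k) * omega d ((j - k) * m))"
    unfolding dft_cyc_index[OF x d] dft_cyc_index[OF y d] cnj_sum sum_product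
    by (intro sum.cong refl) (simp add: mult_ac omega)
  \<comment> \<open>With the frequency \<open>m\<close> summed innermost, orthogonality of
    characters removes all terms with \<open>j \<noteq> k\<close>.\<close>
  also have "\<dots> = (\<Sum>j\<in>?D. \<Sum>k\<in>?D. \<Sum>m\<in>?D. x $\<^sub>c j * cnj (y $\<^sub>c k) * omega d ((j - k) * m))"
    by (subst sum.swap) (rule sum.cong[OF refl], rule sum.swap)
  also have "\<dots> = (\<Sum>j\<in>?D. \<Sum>k\<in>?D. x $\<^sub>c j * cnj (y $\<^sub>c k) *
      (if k = j then of_nat d else 0))"
  proof (intro sum.cong refl)
    fix j k assume "j \<in> ?D" "k \<in> ?D"
    then have "int d dvd j - k \<longleftrightarrow> k = j"
      by (auto simp flip: mod_eq_dvd_iff)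
    then show "(\<Sum>m\<in>?D. x $\<^sub>c j * cnj (y $\<^sub>c k) * omega d ((j - k) * m)) =
        x $\<^sub>c j * cnj (y $\<^sub>c k) * (if k = j then of_nat d else 0)"
      unfolding sum_distrib_left[symmetric] sum_omega[OF d] by simp
  qed
  also have "\<dots> = of_nat d * (\<Sum>j\<in>?D. x $\<^sub>c j * cnj (y $\<^sub>c j))"
    by (simp add: if_distrib sum_distrib_left mult_ac cong: if_cong)
  also have "(\<Sum>j\<in>?D. x $\<^sub>c j * cnj (y $\<^sub>c j)) = x \<bullet>c y"
  proof -
    have "x \<bullet>c y = (\<Sum>j = 0..<d. x $ j * cnj (y $ j))"
      using x y by (simp add: scalar_prod_def)
    also have "\<dots> = (\<Sum>j\<in>?D. x $\<^sub>c j * cnj (y $\<^sub>c j))"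
      using x y by (intro sum_nat_eq_sum_int) (simp add: cyc_index_of_nat)
    finally show ?thesis by simp
  qed
  finally show ?thesis .
qed

text \<open>By Parseval, \<open>x - y\<close> has norm zero.\<close>

lemma dft_inject:
  assumes x: "x \<in> carrier_vec d" and y: "y \<in> carrier_vec d" and d: "d \<ge> 1"
    and eq: "\<And>k. dft x $\<^sub>c k = dft y $\<^sub>c k"
  shows "x = y"
proof -
  have z: "x - y \<in> carrier_vec d" using x y by simp
  have "dft (x - y) $\<^sub>c k = dft x $\<^sub>c k - dft y $\<^sub>c k" for k
    unfolding dft_cyc_index[OF x d] dft_cyc_index[OF y d] dft_cyc_index[OF z d]
      sum_subtractf[symmetric]
    using x y d by (intro sum.cong refl) (simp add: cyc_index_def nat_less_iff right_diff_distrib)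
  then have "(x - y) \<bullet>c (x - y) = 0"
    using scalar_prod_dft[OF z z d] d by (simp add: eq)
  then have "x - y = 0\<^sub>v d"
    using z conjugate_square_eq_0_vec by blast
  show ?thesis
  proof (rule eq_vecI)
    fix i assume "i < dim_vec y"
    then have "(x - y) $ i = 0" using \<open>x - y = 0\<^sub>v d\<close> y by simp
    then show "x $ i = y $ i" using \<open>i < dim_vec y\<close> by simp
  qed (use x y in simp)
qed

lemma dft_smult:
  assumes x: "x \<in> carrier_vec d" and d: "d \<ge> 1"
  shows "dft (s \<cdot>\<^sub>v x) $\<^sub>c k = s * dft x $\<^sub>c k"
proof -
  have sx: "s \<cdot>\<^sub>v x \<in> carrier_vec d" using x by simp
  show ?thesis
    unfolding dft_cyc_index[OF x d] dft_cyc_index[OF sx d] sum_distrib_left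
    using x d by (intro sum.cong refl) (simp add: cyc_index_def nat_less_iff)
qed

section \<open>Recovery of nodes and weights from moments\<close>

text \<open>The moment conditions annihilate every polynomial of degree below \<open>card S\<close>.
  Testing with the Lagrange polynomial that vanishes at all nodes except \<open>t\<close> isolates
  \<open>W t\<close>; left unnormalised, it requires no division.\<close>

lemma vanishing_moments:
  fixes W :: "'a::idom \<Rightarrow> 'a"
  assumes S: "finite S" and mom: "\<And>l. l < card S \<Longrightarrow> (\<Sum>s\<in>S. W s * s ^ l) = 0" and t: "t \<in> S"
  shows "W t = 0"
proof -
  define p where "p = (\<Prod>s\<in>S - {t}. [:- s, 1:])"
  have deg: "degree p < card S"
  proof -
    have "degree p \<le> card (S - {t})"
      unfolding p_def using degree_prod_sum_le[of "S - {t}" "\<lambda>s. [:- s, 1:]"] S by simp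
    then show ?thesis using S t card_gt_0_iff[of S] by (auto simp: card_Diff_singleton)
  qed
  have "(\<Sum>s\<in>S. W s * poly p s) = (\<Sum>s\<in>S. \<Sum>l\<le>degree p. coeff p l * (W s * s ^ l))"
    by (simp add: poly_altdef sum_distrib_left mult_ac)
  also have "\<dots> = (\<Sum>l\<le>degree p. coeff p l * (\<Sum>s\<in>S. W s * s ^ l))"
    by (subst sum.swap) (simp add: sum_distrib_left)
  also have "\<dots> = 0"
    using mom deg by simp
  finally have "(\<Sum>s\<in>S. W s * poly p s) = 0" .
  moreover have "poly p s = 0" if "s \<in> S - {t}" for s
    using that S by (auto simp: p_def poly_prod)
  then have "(\<Sum>s\<in>S - {t}. W s * poly p s) = 0"
    by simp
  ultimately have "W t * poly p t = 0"
    using S t by (simp add: sum.remove)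
  moreover have "poly p t \<noteq> 0"
    using S by (auto simp: p_def poly_prod)
  ultimately show ?thesis by simp
qed

text \<open>The difference of the two weighted point sets lives on at most \<open>2 * card I\<close>
  nodes and has \<open>L\<close> vanishing moments, so it is zero. Since \<open>u\<close> has no
  zeros, each node of \<open>p\<close> is a node of \<open>q\<close>; equal cardinality gives the
  reverse inclusion.\<close>

lemma nodes_and_weights_unique:
  fixes u v :: "'i \<Rightarrow> 'a::idom"
  assumes I: "finite I" and p: "inj_on p I" and q: "inj_on q I" and L: "2 * card I \<le> L"
    and u: "\<And>i. i \<in> I \<Longrightarrow> u i \<noteq> 0"
    and mom: "\<And>l. l < L \<Longrightarrow> (\<Sum>i\<in>I. u i * p i ^ l) = (\<Sum>i\<in>I. v i * q i ^ l)"
  shows "p ` I = q ` I" and "\<And>i j. i \<in> I \<Longrightarrow> j \<in> I \<Longrightarrow> p i = q j \<Longrightarrow> u i = v j"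
proof -
  \<comment> \<open>Weights are re-indexed by nodes and extended by zero, so that both families can
    be subtracted on the union of the node sets.\<close>
  define A where "A s = (if s \<in> p ` I then u (the_inv_into I p s) else 0)" for s
  define B where "B s = (if s \<in> q ` I then v (the_inv_into I q s) else 0)" for s
  have A: "A (p i) = u i" and B: "B (q i) = v i" if "i \<in> I" for i
    using that p q by (auto simp: A_def B_def the_inv_into_f_f)
  let ?S = "p ` I \<union> q ` I"
  have card: "card ?S \<le> L"
    using card_Un_le[of "p ` I" "q ` I"] card_image[OF p] card_image[OF q] L by simp
  have AB: "A t - B t = 0" if t: "t \<in> ?S" for t
  proof (rule vanishing_moments[OF _ _ t])
    fix l assume "l < card ?S"
    then have l: "l < L" using card by simp
    have "(\<Sum>s\<in>?S. A s * s ^ l) = (\<Sum>s\<in>p ` I. A s * s ^ l)"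
      using I by (intro sum.mono_neutral_right) (auto simp: A_def)
    also have "\<dots> = (\<Sum>i\<in>I. u i * p i ^ l)"
      by (simp add: sum.reindex[OF p] A)
    also have "\<dots> = (\<Sum>i\<in>I. v i * q i ^ l)"
      by (rule mom[OF l])
    also have "\<dots> = (\<Sum>s\<in>q ` I. B s * s ^ l)"
      by (simp add: sum.reindex[OF q] B)
    also have "\<dots> = (\<Sum>s\<in>?S. B s * s ^ l)"
      using I by (intro sum.mono_neutral_left) (auto simp: B_def)
    finally show "(\<Sum>s\<in>?S. (A s - B s) * s ^ l) = 0"
      by (simp add: left_diff_distrib sum_subtractf)
  qed (use I in simp)
  have "p ` I \<subseteq> q ` I"
  proof
    fix s assume "s \<in> p ` I"
    then obtain i where i: "i \<in> I" "s = p i" by auto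
    then have "B s \<noteq> 0" using AB[of s] A u by auto
    then show "s \<in> q ` I" by (auto simp: B_def split: if_splits)
  qed
  then show "p ` I = q ` I"
    using I card_image[OF p] card_image[OF q] by (intro card_subset_eq) auto
  show "u i = v j" if "i \<in> I" "j \<in> I" "p i = q j" for i j
    using that AB[of "p i"] A B by fastforce
qed

section \<open>Recovery of a decreasing sequence from its pairwise products\<close>

text \<open>Has the shape of the index set in \<open>collision_free_in_frequency\<close>, which
  therefore unfolds to injectivity on \<open>pairs\<close>.\<close>

definition pairs :: "int \<Rightarrow> (int \<times> int) set" where
  "pairs n = {(j, k). j \<in> {0..n} \<and> k \<in> {0..n} \<and> j \<ge> k}"

lemma pairs_eq_Sigma: "pairs n = (SIGMA j:{0..n}. {0..j})"
  by (auto simp: pairs_def)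

lemma finite_pairs [simp]: "finite (pairs n)"
  by (simp add: pairs_eq_Sigma)

text \<open>Explains the size of \<open>L\<close>: two moments for each unordered pair of
  frequencies up to \<open>d div 2\<close>, one for its node and one for its weight.\<close>

lemma card_pairs: "2 * card (pairs (int n)) = (n + 1) * (n + 2)"
proof (induction n)
  case 0
  have "pairs 0 = {(0, 0)}" by (auto simp: pairs_def)
  then show ?case by simp
next
  case (Suc n)
  have "pairs (int (Suc n)) = pairs (int n) \<union> {int n + 1} \<times> {0..int n + 1}"
    by (auto simp: pairs_def)
  moreover have "pairs (int n) \<inter> {int n + 1} \<times> {0..int n + 1} = {}"
    by (auto simp: pairs_def)
  ultimately have "card (pairs (int (Suc n))) = card (pairs (int n)) + (n + 2)"
    by (simp add: card_Un_disjoint card_cartesian_product)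
  then show ?case using Suc.IH by simp
qed

text \<open>The product \<open>b m * b 0\<close> equals some \<open>b' j * b' k\<close>. If
  \<open>j < m\<close>, both factors would be known values of \<open>b\<close>, contradicting
  injectivity; hence \<open>j \<ge> m\<close>, and monotonicity bounds the product by
  \<open>b' m * b' 0\<close>. The one-sided form lets equality follow by exchanging \<open>b\<close>
  and \<open>b'\<close>.\<close>

lemma decreasing_le_if_products_subset:
  fixes b b' :: "int \<Rightarrow> real"
  assumes pos: "\<And>k. 0 < b k" "\<And>k. 0 < b' k"
    and dec': "\<And>j k. 0 \<le> j \<Longrightarrow> j < k \<Longrightarrow> k \<le> n \<Longrightarrow> b' k < b' j"
    and inj: "inj_on (\<lambda>(j, k). b j * b k) (pairs n)"
    and sub: "(\<lambda>(j, k). b j * b k) ` pairs n \<subseteq> (\<lambda>(j, k). b' j * b' k) ` pairs n"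
    and m: "0 \<le> m" "m \<le> n"
    and prev: "\<And>k. 0 \<le> k \<Longrightarrow> k < m \<Longrightarrow> b k = b' k"
  shows "b m \<le> b' m"
proof -
  have b'_mono: "b' k \<le> b' j" if "0 \<le> j" "j \<le> k" "k \<le> n" for j k
    using that dec'[of j k] by (cases "j = k") auto
  have "(m, 0) \<in> pairs n" using m by (simp add: pairs_def)
  then have "b m * b 0 \<in> (\<lambda>(j, k). b' j * b' k) ` pairs n"
    using sub by (force simp: image_subset_iff)
  then obtain j k where jk: "(j, k) \<in> pairs n" "b m * b 0 = b' j * b' k"
    by auto
  have bounds: "0 \<le> k" "k \<le> j" "j \<le> n" using jk(1) by (auto simp: pairs_def)
  have "m \<le> j"
  proof (rule ccontr)
    assume "\<not> m \<le> j"
    then have "b j = b' j" "b k = b' k" using prev bounds by auto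
    then have "(m, 0) = (j, k)"
      using inj_onD[OF inj, of "(m, 0)" "(j, k)"] jk \<open>(m, 0) \<in> pairs n\<close> by simp
    then show False using \<open>\<not> m \<le> j\<close> by simp
  qed
  then have le: "b m * b 0 \<le> b' m * b' 0"
    unfolding jk(2) using b'_mono bounds m pos by (intro mult_mono) (auto intro: less_imp_le)
  show ?thesis
  \<comment> \<open>At \<open>m = 0\<close> no earlier value is known and squares are compared;
    later the common factor \<open>b 0\<close> cancels.\<close>
  proof (cases "m = 0")
    case True
    then have "(b 0)\<^sup>2 \<le> (b' 0)\<^sup>2" using le by (simp add: power2_eq_square)
    then show ?thesis using True pos(2)[of 0] by (auto dest: power2_le_imp_le)
  next
    case False
    then have "b' 0 = b 0" using prev[of 0] m by simp
    then show ?thesis using le pos(1)[of 0] by simp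
  qed
qed

lemma decreasing_eq_if_products_eq:
  fixes b b' :: "int \<Rightarrow> real"
  assumes pos: "\<And>k. 0 < b k" "\<And>k. 0 < b' k"
    and dec: "\<And>j k. 0 \<le> j \<Longrightarrow> j < k \<Longrightarrow> k \<le> n \<Longrightarrow> b k < b j"
    and dec': "\<And>j k. 0 \<le> j \<Longrightarrow> j < k \<Longrightarrow> k \<le> n \<Longrightarrow> b' k < b' j"
    and inj: "inj_on (\<lambda>(j, k). b j * b k) (pairs n)"
    and inj': "inj_on (\<lambda>(j, k). b' j * b' k) (pairs n)"
    and eq: "(\<lambda>(j, k). b j * b k) ` pairs n = (\<lambda>(j, k). b' j * b' k) ` pairs n"
    and m: "0 \<le> m" "m \<le> n"
  shows "b m = b' m"
  using m
proof (induction "nat m" arbitrary: m rule: less_induct)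
  case less
  have prev: "b k = b' k" if "0 \<le> k" "k < m" for k
    using less that by simp
  show ?case
  proof (rule antisym)
    show "b m \<le> b' m"
      by (rule decreasing_le_if_products_subset[OF pos dec' inj]) (use eq less.prems prev in auto)
    show "b' m \<le> b m"
      by (rule decreasing_le_if_products_subset[OF pos(2,1) dec inj']) (use eq less.prems prev in auto)
  qed
qed

section \<open>Linear independence\<close>

text \<open>By dimension the family spans the space, so \<open>y\<close> is orthogonal to
  itself.\<close>

lemma orthogonal_independent_family_eq_0:
  fixes f :: "'i \<Rightarrow> 'v::euclidean_space"
  assumes ind: "independent_family f I" and card: "card I = DIM('v)"
    and orth: "\<And>i. i \<in> I \<Longrightarrow> inner y (f i) = 0"
  shows "y = 0"
proof -
  have "inj_on f I" "independent (f ` I)" using ind by (auto simp: independent_family_def)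
  moreover have "card (f ` I) = DIM('v)" using card card_image[OF \<open>inj_on f I\<close>] by simp
  ultimately have "span (f ` I) = UNIV"
    using dim_eq_full[of "f ` I"] dim_eq_card_independent[of "f ` I"] by simp
  then have "y \<in> span (f ` I)" by simp
  then have "orthogonal y y"
    by (rule orthogonal_to_span) (auto simp: orthogonal_def orth)
  then show ?thesis by (simp add: orthogonal_def)
qed

text \<open>\<open>Re (cnj u * g i + cnj v * h i)\<close> is the Euclidean inner product of the real
  coordinate vectors of \<open>(u, v)\<close> and \<open>(g i, h i)\<close>.\<close>

lemma Re_combination_determines:
  fixes g h :: "'i \<Rightarrow> complex"
  assumes ind: "independent_family (\<lambda>i. (Re (g i), Im (g i), Re (h i), Im (h i))) I"
    and card: "card I = 4"
    and eq: "\<And>i. i \<in> I \<Longrightarrow> Re (cnj u * g i + cnj v * h i) = Re (cnj u' * g i + cnj v' * h i)"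
  shows "u = u' \<and> v = v'"
proof -
  have "(Re (u - u'), Im (u - u'), Re (v - v'), Im (v - v')) = 0"
  proof (rule orthogonal_independent_family_eq_0[OF ind])
    show "inner (Re (u - u'), Im (u - u'), Re (v - v'), Im (v - v'))
        (Re (g i), Im (g i), Re (h i), Im (h i)) = 0" if "i \<in> I" for i
      using eq[OF that] by (simp add: left_diff_distrib)
  qed (simp add: card)
  then show ?thesis by (simp add: complex_eq_iff zero_prod_def)
qed

text \<open>Multiplying \<open>u\<close> and \<open>v\<close> by \<open>\<i>\<close> turns the
  imaginary part into a real part. If all imaginary parts vanished,
  \<open>(\<i> * u, \<i> * v)\<close> would be indistinguishable from \<open>(0, 0)\<close>.\<close>

lemma ex_Im_combination_nonzero:
  fixes g h :: "'i \<Rightarrow> complex"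
  assumes ind: "independent_family (\<lambda>i. (Re (g i), Im (g i), Re (h i), Im (h i))) I"
    and card: "card I = 4" and nz: "u \<noteq> 0 \<or> v \<noteq> 0"
  shows "\<exists>i\<in>I. Im (cnj u * g i + cnj v * h i) \<noteq> 0"
proof (rule ccontr)
  assume Im: "\<not> ?thesis"
  have eq: "Re (cnj (\<i> * u) * g i + cnj (\<i> * v) * h i) = Re (cnj 0 * g i + cnj 0 * h i)"
    if "i \<in> I" for i
  proof -
    have "cnj (\<i> * u) * g i + cnj (\<i> * v) * h i = - (\<i> * (cnj u * g i + cnj v * h i))"
      by (simp add: distrib_left mult.assoc)
    moreover have "Re (- (\<i> * w)) = Im w" for w by simp
    ultimately have "Re (cnj (\<i> * u) * g i + cnj (\<i> * v) * h i) = Im (cnj u * g i + cnj v * h i)"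
      by metis
    also have "\<dots> = 0" using Im that by metis
    finally show ?thesis by simp
  qed
  have "\<i> * u = 0 \<and> \<i> * v = 0"
    by (rule Re_combination_determines[OF ind card eq])
  then show False using nz by simp
qed

text \<open>\<open>Im (cnj z * w)\<close> is the determinant of \<open>z\<close> and
  \<open>w\<close> as vectors in the real plane, so Cramer's rule applies to the difference of
  \<open>u\<close> and \<open>u'\<close>.\<close>

lemma eq_if_Re_mult_eq:
  fixes u u' z w :: complex
  assumes z: "Re (cnj u * z) = Re (cnj u' * z)" and w: "Re (cnj u * w) = Re (cnj u' * w)"
    and ind: "Im (cnj z * w) \<noteq> 0"
  shows "u = u'"
proof -
  define p q where "p = Re u - Re u'" and "q = Im u - Im u'"
  have 1: "p * Re z + q * Im z = 0" and 2: "p * Re w + q * Im w = 0"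
    using z w by (simp_all add: p_def q_def left_diff_distrib)
  have "p * (Re z * Im w - Im z * Re w) = (p * Re z + q * Im z) * Im w - (p * Re w + q * Im w) * Im z"
    by (simp add: algebra_simps)
  moreover have "q * (Re z * Im w - Im z * Re w) = (p * Re w + q * Im w) * Re z - (p * Re z + q * Im z) * Re w"
    by (simp add: algebra_simps)
  moreover have "Re z * Im w - Im z * Re w \<noteq> 0" using ind by simp
  ultimately have "p = 0" "q = 0" unfolding 1 2 by simp_all
  then show ?thesis by (simp add: p_def q_def complex_eq_iff)
qed

section \<open>Samples as moments\<close>

lemma sum_square_eq_sum_pairs:
  fixes g :: "int \<Rightarrow> int \<Rightarrow> real"
  assumes sym: "\<And>j k. g j k = g k j"
  shows "(\<Sum>j\<in>{0..n}. \<Sum>k\<in>{0..n}. g j k) = (\<Sum>(j, k)\<in>pairs n. (if j = k then 1 else 2) * g j k)"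
proof -
  define U where "U = {(j, k). j \<in> {0..n} \<and> k \<in> {0..n} \<and> j < k}"
  have U: "finite U" by (rule finite_subset[of _ "{0..n} \<times> {0..n}"]) (auto simp: U_def)
  have "{0..n} \<times> {0..n} = pairs n \<union> U" "pairs n \<inter> U = {}"
    by (auto simp: U_def pairs_def)
  then have "(\<Sum>j\<in>{0..n}. \<Sum>k\<in>{0..n}. g j k) = (\<Sum>(j, k)\<in>pairs n. g j k) + (\<Sum>(j, k)\<in>U. g j k)"
    using U by (simp add: sum.cartesian_product sum.union_disjoint)
  also have "(\<Sum>(j, k)\<in>U. g j k) = (\<Sum>(j, k)\<in>{(j, k) \<in> pairs n. j \<noteq> k}. g j k)"
    by (rule sum.reindex_bij_witness[of _ prod.swap prod.swap])
       (use sym in \<open>auto simp: U_def pairs_def\<close>)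
  also have "\<dots> = (\<Sum>(j, k)\<in>pairs n. if j = k then 0 else g j k)"
    by (rule sum.mono_neutral_cong_left) auto
  also have "(\<Sum>(j, k)\<in>pairs n. g j k) + \<dots> = (\<Sum>(j, k)\<in>pairs n. (if j = k then 1 else 2) * g j k)"
    unfolding sum.distrib[symmetric] by (rule sum.cong) auto
  finally show ?thesis .
qed

section \<open>Spectrum, symmetrised coefficients and the moment formula\<close>

definition spectrum :: "real vec \<Rightarrow> int \<Rightarrow> real" where
  "spectrum a k = Re (dft (complexify a) $\<^sub>c k)"

definition coef :: "complex vec \<Rightarrow> complex vec \<Rightarrow> int \<Rightarrow> complex" where
  "coef x \<phi> k = cnj (dft x $\<^sub>c k) * dft \<phi> $\<^sub>c k"

text \<open>Because the spectrum is even, the frequencies \<open>k\<close> and \<open>- k\<close>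
  enter the samples only through this sum.\<close>

definition sym_coef :: "complex vec \<Rightarrow> complex vec \<Rightarrow> int \<Rightarrow> complex" where
  "sym_coef x \<phi> k = coef x \<phi> k + coef x \<phi> (- k)"

definition pair_weight :: "nat \<Rightarrow> int \<Rightarrow> int \<Rightarrow> real" where
  "pair_weight d j k = (if j = k then 1 else 2) * (fold_weight d j * fold_weight d k)"

lemma pair_weight_pos: "pair_weight d j k > 0"
  by (simp add: pair_weight_def fold_weight_pos)

lemma dft_eq_spectrum:
  "strict_sym_decreasing a \<Longrightarrow> dft (complexify a) $\<^sub>c k = of_real (spectrum a k)"
  by (simp add: strict_sym_decreasing_def spectrum_def Let_def)

lemma spectrum_pos: "strict_sym_decreasing a \<Longrightarrow> spectrum a k > 0"
  by (simp add: strict_sym_decreasing_def spectrum_def Let_def)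

lemma spectrum_minus: "strict_sym_decreasing a \<Longrightarrow> spectrum a (- k) = spectrum a k"
  unfolding strict_sym_decreasing_def spectrum_def Let_def by metis

lemma spectrum_less:
  assumes "strict_sym_decreasing a" "0 \<le> j" "j < k" "k \<le> int (dim_vec a) div 2"
  shows "spectrum a k < spectrum a j"
  using assms by (simp add: strict_sym_decreasing_def spectrum_def Let_def)

lemma spectrum_mod: "dim_vec a = d \<Longrightarrow> spectrum a (k mod int d) = spectrum a k"
  by (simp add: spectrum_def)

lemma inj_on_spectrum_products:
  assumes dec: "strict_sym_decreasing a" and col: "collision_free_in_frequency a"
    and dim: "dim_vec a = d"
  shows "inj_on (\<lambda>(j, k). spectrum a j * spectrum a k) (pairs (int d div 2))"
proof (rule inj_onI, clarify)
  fix j k j' k'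
  assume "(j, k) \<in> pairs (int d div 2)" "(j', k') \<in> pairs (int d div 2)"
    and eq: "spectrum a j * spectrum a k = spectrum a j' * spectrum a k'"
  moreover have "dft (complexify a) $\<^sub>c j * dft (complexify a) $\<^sub>c k =
      dft (complexify a) $\<^sub>c j' * dft (complexify a) $\<^sub>c k'"
    unfolding dft_eq_spectrum[OF dec] of_real_mult[symmetric] eq ..
  ultimately have "(j, k) = (j', k')"
    using col inj_onD[where f = "\<lambda>(j, k). dft (complexify a) $\<^sub>c j * dft (complexify a) $\<^sub>c k"
        and x = "(j, k)" and y = "(j', k')" and A = "pairs (int d div 2)"]
    unfolding collision_free_in_frequency_def Let_def pairs_def dim by simp
  then show "j = j' \<and> k = k'" by simp
qed

lemma sample_eq_cmod_sum:
  assumes a: "a \<in> carrier_vec d" and x: "x \<in> carrier_vec d" and f: "f \<in> carrier_vec d"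
    and d: "d \<ge> 1" and dec: "strict_sym_decreasing a"
  shows "real d * sample a x f l = cmod (\<Sum>k\<in>{0..int d div 2}.
    of_real (spectrum a k ^ l * fold_weight d k) * sym_coef x f k)"
proof -
  have ca: "complexify a \<in> carrier_vec d" using a by simp
  define y where "y = (circ (complexify a) ^\<^sub>m l) *\<^sub>v f"
  have y: "y \<in> carrier_vec d"
    unfolding y_def by (rule mult_mat_vec_carrier[OF pow_carrier_mat[OF circ_carrier[OF ca]] f])
  let ?g = "\<lambda>k. of_real (spectrum a k ^ l) * coef x f k"
  \<comment> \<open>Conjugation preserves the modulus and puts the bar on the transform of
    \<open>x\<close>, as in \<open>coef\<close>; the real spectrum is unaffected.\<close>
  have "of_nat d * cnj (x \<bullet>c y) = cnj (of_nat d * (x \<bullet>c y))" by simp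
  also have "\<dots> = (\<Sum>k\<in>{0..<int d}. ?g k)"
    unfolding scalar_prod_dft[OF x y d, symmetric] cnj_sum
    unfolding y_def dft_circ_power_mult[OF ca f d] dft_eq_spectrum[OF dec]
    by (intro sum.cong refl) (simp add: coef_def mult_ac)
  also have "\<dots> = (\<Sum>k\<in>{0..int d div 2}. of_real (fold_weight d k) * (?g k + ?g (- k)))"
    by (rule sum_residues_fold[OF d]) (use a x f in \<open>simp add: spectrum_mod coef_def\<close>)
  also have "\<dots> = (\<Sum>k\<in>{0..int d div 2}.
      of_real (spectrum a k ^ l * fold_weight d k) * sym_coef x f k)"
    by (intro sum.cong refl) (simp add: spectrum_minus[OF dec] sym_coef_def algebra_simps)
  finally have "cmod (of_nat d * cnj (x \<bullet>c y)) = cmod (\<Sum>k\<in>{0..int d div 2}.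
      of_real (spectrum a k ^ l * fold_weight d k) * sym_coef x f k)" by simp
  then show ?thesis by (simp add: sample_def y_def norm_mult)
qed

lemma sample_eq_moment:
  assumes a: "a \<in> carrier_vec d" and x: "x \<in> carrier_vec d" and f: "f \<in> carrier_vec d"
    and d: "d \<ge> 1" and dec: "strict_sym_decreasing a"
  shows "(real d * sample a x f l)\<^sup>2 = (\<Sum>p\<in>pairs (int d div 2).
    (\<lambda>(j, k). pair_weight d j k * Re (sym_coef x f j * cnj (sym_coef x f k))) p *
    (\<lambda>(j, k). spectrum a j * spectrum a k) p ^ l)"
proof -
  define z where "z k = of_real (spectrum a k ^ l * fold_weight d k) * sym_coef x f k" for k
  let ?N = "{0..int d div 2}"
  have "(real d * sample a x f l)\<^sup>2 = (cmod (\<Sum>k\<in>?N. z k))\<^sup>2"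
    by (simp add: sample_eq_cmod_sum[OF a x f d dec] z_def)
  \<comment> \<open>Taking real parts makes the double sum symmetric in \<open>j\<close> and
    \<open>k\<close>, so that it folds onto \<open>pairs\<close>.\<close>
  also have "\<dots> = Re ((\<Sum>k\<in>?N. z k) * cnj (\<Sum>k\<in>?N. z k))"
    by (simp only: complex_norm_square[symmetric] Re_complex_of_real)
  also have "\<dots> = (\<Sum>j\<in>?N. \<Sum>k\<in>?N. Re (z j * cnj (z k)))"
    by (simp only: cnj_sum sum_product Re_sum)
  also have "\<dots> = (\<Sum>(j, k)\<in>pairs (int d div 2). (if j = k then 1 else 2) * Re (z j * cnj (z k)))"
    by (rule sum_square_eq_sum_pairs) (simp add: algebra_simps)
  also have "\<dots> = (\<Sum>p\<in>pairs (int d div 2).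
      (\<lambda>(j, k). pair_weight d j k * Re (sym_coef x f j * cnj (sym_coef x f k))) p *
      (\<lambda>(j, k). spectrum a j * spectrum a k) p ^ l)"
  proof (intro sum.cong refl, clarify)
    fix j k
    have "z j * cnj (z k) = of_real (fold_weight d j * fold_weight d k * (spectrum a j * spectrum a k) ^ l) *
        (sym_coef x f j * cnj (sym_coef x f k))"
      by (simp add: z_def power_mult_distrib mult_ac)
    moreover have "Re (of_real t * w) = t * Re w" for t w by simp
    ultimately have "Re (z j * cnj (z k)) = fold_weight d j * fold_weight d k * (spectrum a j * spectrum a k) ^ l *
        Re (sym_coef x f j * cnj (sym_coef x f k))"
      by (simp only:)
    then show "(if j = k then 1 else 2) * Re (z j * cnj (z k)) =
        (pair_weight d j k * Re (sym_coef x f j * cnj (sym_coef x f k))) *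
        (spectrum a j * spectrum a k) ^ l"
      by (simp add: pair_weight_def)
  qed
  finally show ?thesis .
qed

text \<open>For a single sampling vector, the nodes carry the kernel and the weights carry the real
  part of the Gram matrix of the symmetrised coefficients.\<close>

lemma samples_determine:
  assumes d: "d \<ge> 1" and a: "a \<in> carrier_vec d" and x: "x \<in> carrier_vec d"
    and a': "a' \<in> carrier_vec d" and x': "x' \<in> carrier_vec d" and f: "f \<in> carrier_vec d"
    and dec: "strict_sym_decreasing a" and dec': "strict_sym_decreasing a'"
    and col: "collision_free_in_frequency a" and col': "collision_free_in_frequency a'"
    and nz: "\<And>k j. k \<in> {0..int d div 2} \<Longrightarrow> j \<in> {0..int d div 2} \<Longrightarrow>
      Re (sym_coef x f k * cnj (sym_coef x f j)) \<noteq> 0"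
    and eq: "\<And>l. l < (d div 2 + 1) * (d div 2 + 2) \<Longrightarrow> sample a' x' f l = sample a x f l"
  shows "a' = a"
    and "\<And>k j. k \<in> {0..int d div 2} \<Longrightarrow> j \<in> {0..int d div 2} \<Longrightarrow>
      Re (sym_coef x' f k * cnj (sym_coef x' f j)) = Re (sym_coef x f k * cnj (sym_coef x f j))"
proof -
  let ?n = "int d div 2"
  let ?P = "\<lambda>a (j, k). spectrum a j * spectrum a k"
  let ?W = "\<lambda>x (j, k). pair_weight d j k * Re (sym_coef x f j * cnj (sym_coef x f k))"
  have dim: "dim_vec a = d" "dim_vec a' = d" using a a' by auto
  note inj = inj_on_spectrum_products[OF dec col dim(1)] inj_on_spectrum_products[OF dec' col' dim(2)]
  have card: "2 * card (pairs ?n) \<le> (d div 2 + 1) * (d div 2 + 2)"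
    using card_pairs[of "d div 2"] by (simp add: zdiv_int)
  have W_nz: "?W x p \<noteq> 0" if "p \<in> pairs ?n" for p
  proof -
    obtain j k where jk: "p = (j, k)" by fastforce
    then have "j \<in> {0..?n}" "k \<in> {0..?n}" using that by (auto simp: pairs_def)
    from nz[OF this] show ?thesis
      unfolding jk case_prod_conv mult_eq_0_iff using pair_weight_pos[of d j k] by (metis less_irrefl)
  qed
  have moments: "(\<Sum>p\<in>pairs ?n. ?W x p * ?P a p ^ l) = (\<Sum>p\<in>pairs ?n. ?W x' p * ?P a' p ^ l)"
    if "l < (d div 2 + 1) * (d div 2 + 2)" for l
    unfolding sample_eq_moment[OF a x f d dec, symmetric] sample_eq_moment[OF a' x' f d dec', symmetric]
      eq[OF that] ..
  have nodes: "?P a ` pairs ?n = ?P a' ` pairs ?n"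
    by (rule nodes_and_weights_unique(1)[OF finite_pairs inj card W_nz moments])
  have weights_eq: "?W x p = ?W x' q" if "p \<in> pairs ?n" "q \<in> pairs ?n" "?P a p = ?P a' q" for p q
    by (rule nodes_and_weights_unique(2)[OF finite_pairs inj card W_nz moments that])
  have spec: "spectrum a k = spectrum a' k" if "0 \<le> k" "k \<le> ?n" for k
  proof (rule decreasing_eq_if_products_eq[OF spectrum_pos[OF dec] spectrum_pos[OF dec'] _ _ inj nodes that])
    show "spectrum a l < spectrum a j" "spectrum a' l < spectrum a' j"
      if "0 \<le> j" "j < l" "l \<le> ?n" for j l
      using that spectrum_less[OF dec] spectrum_less[OF dec'] by (simp_all add: dim)
  qed
  \<comment> \<open>Residues beyond \<open>?n\<close> are reached by evenness:
    \<open>int d - r\<close> represents \<open>- r\<close> and lies in the lower half.\<close>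
  have spec_all: "spectrum a k = spectrum a' k" for k
  proof -
    define r where "r = k mod int d"
    have r: "0 \<le> r" "r < int d" using d by (auto simp: r_def)
    have "spectrum a r = spectrum a' r"
    proof (cases "r \<le> ?n")
      case False
      have "spectrum b r = spectrum b (int d - r)" if "strict_sym_decreasing b" "dim_vec b = d" for b
      proof -
        have "spectrum b (int d - r) = spectrum b ((int d - r) mod int d)"
          by (simp only: spectrum_mod that)
        also have "\<dots> = spectrum b (- r)"
          by (simp only: minus_mod_self1 spectrum_mod that)
        finally show ?thesis by (simp add: spectrum_minus that)
      qed
      then show ?thesis using spec[of "int d - r"] r False dec dec' dim by simp
    qed (use spec r in auto)
    then show ?thesis by (simp add: r_def spectrum_mod dim)
  qed
  have "complexify a' = complexify a"
    using a a' by (intro dft_inject[OF _ _ d])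
      (simp_all add: dft_eq_spectrum[OF dec] dft_eq_spectrum[OF dec'] spec_all)
  then show a'_eq: "a' = a"
    by (metis dim index_map_vec(1) of_real_eq_iff eq_vecI)
  have weights: "Re (sym_coef x' f k * cnj (sym_coef x' f j)) = Re (sym_coef x f k * cnj (sym_coef x f j))"
    if "(k, j) \<in> pairs ?n" for k j
  proof -
    \<comment> \<open>The kernels agree, so the node functions coincide and weights can be compared
      at the same index pair.\<close>
    have "?W x (k, j) = ?W x' (k, j)"
      by (rule weights_eq[OF that that]) (simp add: a'_eq)
    then show ?thesis
      unfolding case_prod_conv using pair_weight_pos[of d k j] by (metis mult_left_cancel less_irrefl)
  qed
  show "Re (sym_coef x' f k * cnj (sym_coef x' f j)) = Re (sym_coef x f k * cnj (sym_coef x f j))"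
    if "k \<in> {0..?n}" "j \<in> {0..?n}" for k j
  proof (cases "j \<le> k")
    case True
    then show ?thesis using that by (intro weights) (auto simp: pairs_def)
  next
    case False
    then have "(j, k) \<in> pairs ?n" using that by (auto simp: pairs_def)
    have swap: "Re (z * cnj w) = Re (w * cnj z)" for z w
      by (simp add: mult.commute)
    show ?thesis
      using weights[OF \<open>(j, k) \<in> pairs ?n\<close>]
        swap[of "sym_coef x f k" "sym_coef x f j"] swap[of "sym_coef x' f k" "sym_coef x' f j"]
      by (simp only:)
  qed
qed

section \<open>Recovery up to phase\<close>

text \<open>For \<open>d = 2\<close> the independence condition would be vacuous although the
  Nyquist frequency is \<open>1\<close>. Four equal sampling vectors with transform
  \<open>(1, 1)\<close> then give the same Gram data for signals with transforms
  \<open>(1, 1 + \<i>)\<close> and \<open>(1, 1 - \<i>)\<close>, which differ by more than a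
  phase.\<close>

theorem theorem6p5:
  fixes d :: nat and a :: "real vec" and x :: "complex vec"
    and \<phi> :: "nat \<Rightarrow> complex vec" and c :: "nat \<Rightarrow> int \<Rightarrow> complex"
  assumes d_pos: "d \<ge> 1" and d_not_2: "d \<noteq> 2"
    and a_dim: "a \<in> carrier_vec d" and x_dim: "x \<in> carrier_vec d"
    and phi_dim: "\<And>i. i \<in> {1..4} \<Longrightarrow> \<phi> i \<in> carrier_vec d"
    and a_decreasing: "strict_sym_decreasing a"
    and a_collision_free: "collision_free_in_frequency a"
    and c_def: "\<And>i k. c i k = cnj (dft x $\<^sub>c k) * dft (\<phi> i) $\<^sub>c k"
    and nonvanishing: "\<And>i k j. i \<in> {1..4} \<Longrightarrow> k \<in> {0..int d div 2} \<Longrightarrow> j \<in> {0..int d div 2} \<Longrightarrow>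
          Re ((c i k + c i (- k)) * cnj (c i j + c i (- j))) \<noteq> 0"
    and lin_indep: "\<And>k. k \<in> {1..(int d - 1) div 2} \<Longrightarrow>
          independent_family
            (\<lambda>i. (Re (cnj (c i 0) * dft (\<phi> i) $\<^sub>c k), Im (cnj (c i 0) * dft (\<phi> i) $\<^sub>c k),
                  Re (cnj (c i 0) * dft (\<phi> i) $\<^sub>c (- k)), Im (cnj (c i 0) * dft (\<phi> i) $\<^sub>c (- k))))
            {1..4}"
  shows "recoverable_up_to_phase \<phi> ((d div 2 + 1) * (d div 2 + 2)) a x"
  unfolding recoverable_up_to_phase_def
proof (intro ballI impI)
  fix a' x'
  assume "a' \<in> carrier_vec (dim_vec a)" "x' \<in> carrier_vec (dim_vec x)"
    and a'_dec: "strict_sym_decreasing a'" and a'_col: "collision_free_in_frequency a'"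
    and samples: "\<forall>l<(d div 2 + 1) * (d div 2 + 2). \<forall>i\<in>{1..4}.
      sample a' x' (\<phi> i) l = sample a x (\<phi> i) l"
  then have a': "a' \<in> carrier_vec d" and x': "x' \<in> carrier_vec d"
    using a_dim x_dim by auto
  let ?N = "{0..int d div 2}"
  define f where "f i k = dft (\<phi> i) $\<^sub>c k" for i k
  define X where "X k = dft x $\<^sub>c k" for k
  define X' where "X' k = dft x' $\<^sub>c k" for k
  define S where "S i k = sym_coef x (\<phi> i) k" for i k
  define S' where "S' i k = sym_coef x' (\<phi> i) k" for i k
  have S: "S i k = cnj (X k) * f i k + cnj (X (- k)) * f i (- k)" for i k
    by (simp add: S_def X_def f_def sym_coef_def coef_def)
  have S': "S' i k = cnj (X' k) * f i k + cnj (X' (- k)) * f i (- k)" for i k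
    by (simp add: S'_def X'_def f_def sym_coef_def coef_def)
  have c: "c i k = cnj (X k) * f i k" for i k
    by (simp add: c_def X_def f_def)
  have S_nz: "Re (S i k * cnj (S i j)) \<noteq> 0" if "i \<in> {1..4}" "k \<in> ?N" "j \<in> ?N" for i k j
    using nonvanishing[OF that] by (simp add: S c)
  have det: "a' = a"
      "k \<in> ?N \<Longrightarrow> j \<in> ?N \<Longrightarrow> Re (S' i k * cnj (S' i j)) = Re (S i k * cnj (S i j))"
    if i: "i \<in> {1..4}" for i k j
    using samples_determine[OF d_pos a_dim x_dim a' x' phi_dim[OF i] a_decreasing a'_dec
        a_collision_free a'_col] S_nz[OF i] samples i unfolding S_def S'_def by blast+
  have S0: "S i 0 = 2 * c i 0" for i by (simp add: S c)
  have c0: "c i 0 \<noteq> 0" if "i \<in> {1..4}" for i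
    using S_nz[OF that, of 0 0] by (auto simp: S0)
  have X0: "X 0 \<noteq> 0" and f0: "f 1 0 \<noteq> 0"
    using c0[of 1] by (auto simp: c)
  \<comment> \<open>The global phase is read off at frequency \<open>0\<close>, where the signal is
    nonzero on the Fourier side.\<close>
  define \<theta> where "\<theta> = X' 0 / X 0"
  have "(cmod (X' 0))\<^sup>2 = (cmod (X 0))\<^sup>2"
  proof -
    have "(cmod (S' 1 0))\<^sup>2 = (cmod (S 1 0))\<^sup>2"
      using det(2)[of 1 0 0] unfolding complex_norm_square[symmetric] Re_complex_of_real by simp
    moreover have "S' 1 0 = 2 * cnj (X' 0) * f 1 0" "S 1 0 = 2 * cnj (X 0) * f 1 0"
      by (simp_all add: S S')
    ultimately show ?thesis using f0 by (simp add: norm_mult power_mult_distrib)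
  qed
  then have \<theta>: "cmod \<theta> = 1"
    using X0 by (simp add: \<theta>_def norm_divide)
  then have \<theta>_cnj: "\<theta> * cnj \<theta> = 1"
    by (simp flip: complex_norm_square)
  \<comment> \<open>Removing the phase from \<open>X'\<close> makes it agree with \<open>X\<close>
    at frequency \<open>0\<close> and leaves the Gram data unchanged.\<close>
  define Y where "Y k = cnj \<theta> * X' k" for k
  have X'_eq: "X' k = \<theta> * Y k" for k
    using \<theta>_cnj by (simp add: Y_def flip: mult.assoc)
  have Y0: "Y 0 = X 0"
    using X'_eq[of 0] X0 \<theta> by (auto simp: \<theta>_def field_simps)
  define T where "T i k = cnj (Y k) * f i k + cnj (Y (- k)) * f i (- k)" for i k
  have gram: "Re (T i k * cnj (T i j)) = Re (S i k * cnj (S i j))"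
    if "i \<in> {1..4}" "k \<in> ?N" "j \<in> ?N" for i k j
  proof -
    have T: "T i k = \<theta> * S' i k" for k
      by (simp add: T_def Y_def S' algebra_simps)
    have "T i k * cnj (T i j) = (\<theta> * cnj \<theta>) * (S' i k * cnj (S' i j))"
      by (simp add: T)
    then show ?thesis using det(2)[OF that] by (simp add: \<theta>_cnj)
  qed
  have T0: "T i 0 = S i 0" for i by (simp add: T_def S Y0)
  \<comment> \<open>With the entry at \<open>0\<close> fixed, the quadratic Gram data at
    \<open>j = 0\<close> become real-linear in the remaining entries of \<open>Y\<close>.\<close>
  have T_c0: "Re (T i k * cnj (c i 0)) = Re (S i k * cnj (c i 0))"
    if "i \<in> {1..4}" "k \<in> ?N" for i k
    using gram[OF that, of 0] by (simp add: T0 S0)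
  have low: "Y k = X k \<and> Y (- k) = X (- k)" if k: "k \<in> {1..(int d - 1) div 2}" for k
  proof (rule Re_combination_determines[OF lin_indep[OF k]])
    fix i :: nat assume "i \<in> {1..4}"
    moreover have "k \<in> ?N" using k by auto
    ultimately have "Re (T i k * cnj (c i 0)) = Re (S i k * cnj (c i 0))" by (rule T_c0)
    then show "Re (cnj (Y k) * (cnj (c i 0) * dft (\<phi> i) $\<^sub>c k) + cnj (Y (- k)) * (cnj (c i 0) * dft (\<phi> i) $\<^sub>c (- k))) =
        Re (cnj (X k) * (cnj (c i 0) * dft (\<phi> i) $\<^sub>c k) + cnj (X (- k)) * (cnj (c i 0) * dft (\<phi> i) $\<^sub>c (- k)))"
      by (simp add: T_def S ring_distribs mult_ac flip: f_def)
  qed simp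
  \<comment> \<open>The Nyquist frequency is not covered by the independence hypothesis. The entries at frequency
    \<open>1\<close> are already known, and the independence there provides an \<open>i\<close> for which \<open>c i 0\<close> and
    \<open>S i 1\<close> are real-linearly independent; their real products with \<open>T i m\<close> determine \<open>Y m\<close>.\<close>
  have nyquist: "Y m = X m" if m: "2 * m = int d" for m
  proof -
    \<comment> \<open>Excluding \<open>m = 1\<close> places frequency \<open>1\<close> strictly
      below Nyquist, within reach of the independence hypothesis.\<close>
    have "m \<noteq> 1" using m d_not_2 by auto
    then have "m \<ge> 2" using m d_pos by linarith
    then have m_range: "m \<in> ?N" and one: "1 \<in> {1..(int d - 1) div 2}" "1 \<in> ?N"
      by (auto simp flip: m)
    have "X 1 \<noteq> 0 \<or> X (- 1) \<noteq> 0"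
      using S_nz[of 1 1 1] one by (auto simp: S)
    from ex_Im_combination_nonzero[OF lin_indep[OF one(1)] _ this]
    obtain i where i: "i \<in> {1..4}" and
      "Im (cnj (X 1) * (cnj (c i 0) * f i 1) + cnj (X (- 1)) * (cnj (c i 0) * f i (- 1))) \<noteq> 0"
      by (auto simp: f_def)
    then have Im: "Im (S i 1 * cnj (c i 0)) \<noteq> 0"
      by (simp add: S ring_distribs mult_ac)
    have "(- m) mod int d = m mod int d"
      using m by (simp add: mod_eq_dvd_iff)
    then have neg: "f i (- m) = f i m" "X (- m) = X m" "Y (- m) = Y m"
      using phi_dim[OF i] x_dim x' unfolding f_def X_def Y_def X'_def
      by (auto intro!: cyc_index_cong)
    have Tm: "T i m = 2 * (cnj (Y m) * f i m)" and Sm: "S i m = 2 * (cnj (X m) * f i m)"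
      by (simp_all add: T_def S neg)
    have scale: "Re (2 * (p * q) * r) = 2 * Re (p * (q * r))" for p q r :: complex
      by (simp add: algebra_simps)
    have T1: "T i 1 = S i 1" using low[OF one(1)] by (simp add: T_def S)
    have fm: "f i m \<noteq> 0" using S_nz[OF i m_range m_range] Sm by auto
    show ?thesis
    proof (rule eq_if_Re_mult_eq)
      show "Re (cnj (Y m) * (f i m * cnj (c i 0))) = Re (cnj (X m) * (f i m * cnj (c i 0)))"
        using T_c0[OF i m_range] unfolding Tm Sm scale by linarith
      show "Re (cnj (Y m) * (f i m * cnj (S i 1))) = Re (cnj (X m) * (f i m * cnj (S i 1)))"
        using gram[OF i m_range one(2)] unfolding Tm Sm T1 scale by linarith
      \<comment> \<open>The common factor \<open>f i m\<close> scales the determinant by its squared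
        modulus, so the independence of \<open>c i 0\<close> and \<open>S i 1\<close>
        survives.\<close>
      have "cnj (f i m * cnj (c i 0)) * (f i m * cnj (S i 1)) =
          (f i m * cnj (f i m)) * cnj (S i 1 * cnj (c i 0))"
        by (simp add: mult_ac)
      also have "f i m * cnj (f i m) = of_real ((cmod (f i m))\<^sup>2)"
        by (rule complex_norm_square[symmetric])
      finally have "Im (cnj (f i m * cnj (c i 0)) * (f i m * cnj (S i 1))) =
          Im (of_real ((cmod (f i m))\<^sup>2) * cnj (S i 1 * cnj (c i 0)))"
        by (simp only:)
      also have "\<dots> = - ((cmod (f i m))\<^sup>2 * Im (S i 1 * cnj (c i 0)))"
        by (simp add: algebra_simps)
      finally show "Im (cnj (f i m * cnj (c i 0)) * (f i m * cnj (S i 1))) \<noteq> 0"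
        using fm Im by (simp only: neg_equal_0_iff_equal mult_eq_0_iff) simp
    qed
  qed
  have all: "Y k = X k" for k
  proof -
    define r where "r = k mod int d"
    have r: "0 \<le> r" "r < int d" using d_pos by (auto simp: r_def)
    \<comment> \<open>Every residue is zero, strictly below Nyquist, at Nyquist, or the negative of
      one strictly below.\<close>
    then consider "r = 0" | "r \<in> {1..(int d - 1) div 2}" | "2 * r = int d"
      | "int d - r \<in> {1..(int d - 1) div 2}"
      by fastforce
    then have "Y r = X r"
    proof cases
      case 4
      have "r mod int d = (- (int d - r)) mod int d" by simp
      then have "Y r = Y (- (int d - r))" "X r = X (- (int d - r))"
        using x_dim x' unfolding Y_def X'_def X_def by (auto intro!: cyc_index_cong)
      then show ?thesis using low[OF 4] by simp
    qed (use Y0 low nyquist in auto)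
    moreover have "Y r = Y k" "X r = X k"
      using x_dim x' by (simp_all add: Y_def X'_def X_def r_def)
    ultimately show ?thesis by simp
  qed
  have "x' = \<theta> \<cdot>\<^sub>v x"
    using x' x_dim X'_eq by (intro dft_inject[OF _ _ d_pos])
      (simp_all add: dft_smult[OF x_dim d_pos] all flip: X'_def X_def)
  then show "a' = a \<and> (\<exists>\<theta>. cmod \<theta> = 1 \<and> x' = \<theta> \<cdot>\<^sub>v x)"
    using det(1)[of 1] \<theta> by auto
qed

end
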